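(* Let $r\ge2$, let $P$ be an $r$-pattern, and let $\mathcal{F}$ be a family of $r$-graphs, none of whose members has an isolated vertex, that is degree-stable with respect to $\mathrm{Col}(P)$. Then for all sufficiently large $n$ and any $n$-vertex $\mathcal{F}$-free $r$-graph $G$, $$e(G)\le ex(\mathrm{Col}(P),n).$$ Moreover, if equality holds, then $G$ is $P$-colorable.
   Context: An $r$-graph is a finite $r$-uniform hypergraph; $e(G)$ is its number of edges and $\delta(G)$ its minimum degree. An $r$-graph is $\mathcal{F}$-free if it contains no (not necessarily induced) subgraph isomorphic to a member of $\mathcal{F}$. The Turán number $ex(n,\mathcal{F})$ is the maximum number of edges of an $n$-vertex $\mathcal{F}$-free $r$-graph, and $\pi(\mathcal{F})=\lim_{n\to\infty}ex(n,\mathcal{F})/\binom nr$. An $r$-pattern is a pair $P=([l],E)$ with $l$ a positive integer and $E$ a set of $r$-multisets (multisets of cardinality $r$) with elements from $[l]$. An $r$-graph $H$ is $P$-colorable if there is a map $\phi:V(H)\to[l]$ such that for every edge $\{v_1,\dots,v_r\}\in E(H)$ the multiset $\{\phi(v_1),\dots,\phi(v_r)\}$ belongs to $E$. $\mathrm{Col}(P)$ is the family of all $P$-colorable $r$-graphs, and $ex(\mathrm{Col}(P),n)$ is the maximum of $e(H)$ over $n$-vertex $H\in\mathrm{Col}(P)$. Degree stability: let $\mathcal{F}$ be a family of $r$-graphs with $\pi(\mathcal{F})>0$ and let $\mathfrak{H}$ be a family of $\mathcal{F}$-free $r$-graphs. $\mathcal{F}$ is degree-stable with respect to $\mathfrak{H}$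 if there exist constants $n_0$ and $\varepsilon>0$ such that every $\mathcal{F}$-free $r$-graph $\mathcal{H}$ on $n\ge n_0$ vertices with $\delta(\mathcal{H})\ge(\pi(\mathcal{F})/(r-1)!-\varepsilon)n^{r-1}$ is a member of $\mathfrak{H}$. (So the hypothesis includes that $\pi(\mathcal{F})>0$ and that all members of $\mathrm{Col}(P)$ are $\mathcal{F}$-free.) *)

theory Defs
  imports Complex_Main "HOL-Library.Multiset"
begin

text \<open>
  A hypergraph is a pair of a vertex set and an edge set. Vertices are natural numbers: all
  hypergraphs considered are finite, so each is isomorphic to one of these, and families of
  hypergraphs become sets.
\<close>

type_synonym hgraph = "nat set \<times> nat set set"

abbreviation verts :: "hgraph \<Rightarrow> nat set" where "verts \<equiv> fst"
abbreviation edges :: "hgraph \<Rightarrow> nat set set" where "edges \<equiv> snd"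

definition rgraph :: "nat \<Rightarrow> hgraph \<Rightarrow> bool" where
  "rgraph r H \<longleftrightarrow> finite (verts H) \<and> (\<forall>e\<in>edges H. e \<subseteq> verts H \<and> card e = r)"

definition num_edges :: "hgraph \<Rightarrow> nat" where
  "num_edges H = card (edges H)"

definition degree :: "hgraph \<Rightarrow> nat \<Rightarrow> nat" where
  "degree H v = card {e \<in> edges H. v \<in> e}"

text \<open>Unspecified on the hypergraph without vertices.\<close>

definition min_degree :: "hgraph \<Rightarrow> nat" where
  "min_degree H = Min (degree H ` verts H)"

definition has_isolated_vertex :: "hgraph \<Rightarrow> bool" where
  "has_isolated_vertex H \<longleftrightarrow> (\<exists>v\<in>verts H. \<forall>e\<in>edges H. v \<notin> e)"

definition hg_iso :: "hgraph \<Rightarrow> hgraph \<Rightarrow> bool" where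
  "hg_iso H K \<longleftrightarrow> (\<exists>f. bij_betw f (verts H) (verts K) \<and> edges K = (\<lambda>e. f ` e) ` edges H)"

definition subgraph :: "nat \<Rightarrow> hgraph \<Rightarrow> hgraph \<Rightarrow> bool" where
  "subgraph r K H \<longleftrightarrow> rgraph r K \<and> verts K \<subseteq> verts H \<and> edges K \<subseteq> edges H"

definition family_free :: "nat \<Rightarrow> hgraph set \<Rightarrow> hgraph \<Rightarrow> bool" where
  "family_free r \<F> H \<longleftrightarrow> \<not> (\<exists>K. subgraph r K H \<and> (\<exists>F\<in>\<F>. hg_iso F K))"

definition turan :: "nat \<Rightarrow> hgraph set \<Rightarrow> nat \<Rightarrow> nat" where
  "turan r \<F> n = Max {num_edges H | H. rgraph r H \<and> card (verts H) = n \<and> family_free r \<F> H}"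

definition turan_density :: "nat \<Rightarrow> hgraph set \<Rightarrow> real" where
  "turan_density r \<F> = lim (\<lambda>n. real (turan r \<F> n) / real (n choose r))"

type_synonym pattern = "nat \<times> nat multiset set"

definition rpattern :: "nat \<Rightarrow> pattern \<Rightarrow> bool" where
  "rpattern r P \<longleftrightarrow> fst P > 0 \<and> (\<forall>m\<in>snd P. size m = r \<and> set_mset m \<subseteq> {1..fst P})"

definition colorable :: "pattern \<Rightarrow> hgraph \<Rightarrow> bool" where
  "colorable P H \<longleftrightarrow> (\<exists>\<phi>. \<phi> ` verts H \<subseteq> {1..fst P} \<and>
     (\<forall>e\<in>edges H. image_mset \<phi> (mset_set e) \<in> snd P))"

definition Col :: "nat \<Rightarrow> pattern \<Rightarrow> hgraph set" where
  "Col r P = {H. rgraph r H \<and> colorable P H}"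

definition ex_in :: "hgraph set \<Rightarrow> nat \<Rightarrow> nat" where
  "ex_in \<H> n = Max {num_edges H | H. H \<in> \<H> \<and> card (verts H) = n}"

definition degree_stable :: "nat \<Rightarrow> hgraph set \<Rightarrow> hgraph set \<Rightarrow> bool" where
  "degree_stable r \<F> \<H> \<longleftrightarrow>
     turan_density r \<F> > 0 \<and>
     (\<forall>H\<in>\<H>. rgraph r H \<and> family_free r \<F> H) \<and>
     (\<exists>n0::nat. \<exists>\<epsilon>::real. \<epsilon> > 0 \<and>
        (\<forall>H. rgraph r H \<and> family_free r \<F> H \<and> card (verts H) \<ge> n0 \<and>
             real (min_degree H) \<ge>
               (turan_density r \<F> / fact (r - 1) - \<epsilon>) * real (card (verts H)) ^ (r - 1)
           \<longrightarrow> H \<in> \<H>))"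

end

theory Submission
  imports Defs
begin

text \<open>
  Let \<open>c n = ex_in (Col r P) n\<close>. Repeatedly deleting a vertex of degree below the stability
  threshold from a large \<open>\<F>\<close>-free hypergraph gains at least one edge per step against any function
  growing like \<open>\<pi> * (n choose r)\<close>, so it must stop, and it stops at a
  \<open>P\<close>-colorable hypergraph. Started from extremal \<open>\<F>\<close>-free hypergraphs, this
  gives \<open>c n \<ge> \<pi> * (n choose r)\<close>. Cloning a vertex of at least average degree then
  yields \<open>c (n + 1) - c n \<ge> \<pi> * (n - 1 choose (r - 1))\<close>, so \<open>c\<close> itself can serve as the
  comparison function. If \<open>e(G) \<ge> c n\<close> and a vertex is ever deleted from \<open>G\<close>, the process ends
  at a \<open>P\<close>-colorable hypergraph with too many edges. Hence none is deleted, and \<open>G\<close> is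
  \<open>P\<close>-colorable.
\<close>

section \<open>Degrees and vertex deletion\<close>

definition delete_vertex :: "nat \<Rightarrow> hgraph \<Rightarrow> hgraph" where
  "delete_vertex v H = (verts H - {v}, {e \<in> edges H. v \<notin> e})"

text \<open>A common abstraction of the \<F>-free hypergraphs and \<open>Col r P\<close>. The
  edgeless members make the maximum in \<open>ex_in\<close> range over a nonempty set for every
  \<open>n\<close>.\<close>

definition hereditary :: "nat \<Rightarrow> hgraph set \<Rightarrow> bool" where
  "hereditary r \<H> \<longleftrightarrow>
     (\<forall>H\<in>\<H>. rgraph r H \<and> (\<forall>v\<in>verts H. delete_vertex v H \<in> \<H>)) \<and> (\<forall>n. ({..<n}, {}) \<in> \<H>)"

lemma rgraph_edges_subset_Pow: "rgraph r H \<Longrightarrow> edges H \<subseteq> Pow (verts H)"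
  by (auto simp: rgraph_def)

lemma finite_verts: "rgraph r H \<Longrightarrow> finite (verts H)"
  by (simp add: rgraph_def)

lemma finite_edges: "rgraph r H \<Longrightarrow> finite (edges H)"
  using rgraph_edges_subset_Pow finite_verts finite_Pow_iff finite_subset by metis

lemma num_edges_le:
  assumes "rgraph r H"
  shows "num_edges H \<le> 2 ^ card (verts H)"
  using card_mono[OF _ rgraph_edges_subset_Pow[OF assms]] finite_verts[OF assms]
  by (simp add: num_edges_def card_Pow)

lemma rgraph_delete_vertex: "rgraph r H \<Longrightarrow> rgraph r (delete_vertex v H)"
  by (auto simp: rgraph_def delete_vertex_def)

lemma card_verts_delete_vertex:
  "v \<in> verts H \<Longrightarrow> card (verts (delete_vertex v H)) = card (verts H) - 1"
  by (simp add: delete_vertex_def)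

lemma num_edges_delete_vertex:
  assumes "rgraph r H"
  shows "num_edges (delete_vertex v H) + degree H v = num_edges H"
proof -
  have "edges H = {e \<in> edges H. v \<notin> e} \<union> {e \<in> edges H. v \<in> e}" by auto
  moreover have "card ({e \<in> edges H. v \<notin> e} \<union> {e \<in> edges H. v \<in> e}) =
      card {e \<in> edges H. v \<notin> e} + card {e \<in> edges H. v \<in> e}"
    using finite_edges[OF assms] by (intro card_Un_disjoint) auto
  ultimately show ?thesis
    by (simp add: num_edges_def degree_def delete_vertex_def)
qed

lemma sum_degree:
  assumes "rgraph r H"
  shows "(\<Sum>v\<in>verts H. degree H v) = r * num_edges H"
proof -
  have "(\<Sum>v\<in>verts H. degree H v) = (\<Sum>v\<in>verts H. \<Sum>e\<in>edges H. if v \<in> e then 1 else 0)"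
    using finite_edges[OF assms] by (simp add: degree_def flip: sum.inter_filter)
  also have "\<dots> = (\<Sum>e\<in>edges H. \<Sum>v\<in>verts H. if v \<in> e then 1 else 0)"
    by (rule sum.swap)
  also have "\<dots> = (\<Sum>e\<in>edges H. r)"
  proof (intro sum.cong refl)
    fix e assume "e \<in> edges H"
    then have "{v \<in> verts H. v \<in> e} = e" "card e = r"
      using assms by (auto simp: rgraph_def)
    then show "(\<Sum>v\<in>verts H. if v \<in> e then 1 else 0) = r"
      using finite_verts[OF assms] by (simp flip: sum.inter_filter)
  qed
  finally show ?thesis
    by (simp add: num_edges_def)
qed

lemma family_free_subgraph:
  assumes "family_free r \<F> H" "verts K \<subseteq> verts H" "edges K \<subseteq> edges H"
  shows "family_free r \<F> K"
  using assms unfolding family_free_def subgraph_def by blast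

lemma hereditary_family_free:
  assumes "\<And>n. family_free r \<F> ({..<n}, {})"
  shows "hereditary r {H. rgraph r H \<and> family_free r \<F> H}"
proof -
  have "family_free r \<F> (delete_vertex v H)" if "family_free r \<F> H" for v H
    by (rule family_free_subgraph[OF that]) (auto simp: delete_vertex_def)
  then show ?thesis
    using assms by (auto simp: hereditary_def rgraph_delete_vertex rgraph_def[of r "(_, {})"])
qed

lemma hereditary_Col:
  assumes "rpattern r P"
  shows "hereditary r (Col r P)"
proof -
  have "colorable P (delete_vertex v H)" if "colorable P H" for v H
    using that unfolding colorable_def delete_vertex_def by force
  moreover have "colorable P ({..<n}, {})" for n
    using assms by (auto simp: colorable_def rpattern_def intro!: exI[of _ "\<lambda>_. 1"])
  ultimately show ?thesis
    by (auto simp: hereditary_def Col_def rgraph_delete_vertex rgraph_def[of r "(_, {})"])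
qed

section \<open>Extremal numbers of hereditary classes\<close>

lemma finite_num_edges_set:
  assumes "hereditary r \<H>"
  shows "finite {num_edges H | H. H \<in> \<H> \<and> card (verts H) = n}"
proof (rule finite_subset)
  show "{num_edges H | H. H \<in> \<H> \<and> card (verts H) = n} \<subseteq> {..2 ^ n}"
    using assms num_edges_le by (auto simp: hereditary_def)
qed simp

lemma num_edges_le_ex_in:
  assumes "hereditary r \<H>" "H \<in> \<H>"
  shows "num_edges H \<le> ex_in \<H> (card (verts H))"
  unfolding ex_in_def
  by (rule Max_ge[OF finite_num_edges_set[OF assms(1)]]) (use assms(2) in blast)

lemma ex_in_attained:
  assumes "hereditary r \<H>"
  obtains H where "H \<in> \<H>" "card (verts H) = n" "num_edges H = ex_in \<H> n"
proof -
  have "({..<n}, {}) \<in> \<H>"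
    using assms by (simp add: hereditary_def)
  then have "{num_edges H | H. H \<in> \<H> \<and> card (verts H) = n} \<noteq> {}"
    by (auto intro!: exI[of _ "{..<n}"])
  from Max_in[OF finite_num_edges_set[OF assms] this] show ?thesis
    using that by (auto simp: ex_in_def)
qed

lemma turan_eq_ex_in: "turan r \<F> n = ex_in {H. rgraph r H \<and> family_free r \<F> H} n"
  by (simp add: turan_def ex_in_def conj_ac)

text \<open>Delete each vertex in turn from an extremal hypergraph on \<open>Suc n\<close> vertices.
  Every result has at most \<open>ex_in \<H> n\<close> edges, and the degrees lost sum to
  \<open>r\<close> times the number of edges.\<close>

lemma ex_in_Suc_averaging:
  assumes "hereditary r \<H>"
  shows "(Suc n - r) * ex_in \<H> (Suc n) \<le> Suc n * ex_in \<H> n"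
proof -
  obtain H where H: "H \<in> \<H>" "card (verts H) = Suc n" "num_edges H = ex_in \<H> (Suc n)"
    using ex_in_attained[OF assms] .
  have rH: "rgraph r H"
    using assms H(1) by (simp add: hereditary_def)
  have le: "num_edges H \<le> ex_in \<H> n + degree H v" if "v \<in> verts H" for v
  proof -
    have "num_edges (delete_vertex v H) \<le> ex_in \<H> n"
      using num_edges_le_ex_in[OF assms, of "delete_vertex v H"] assms H that
      by (simp add: hereditary_def card_verts_delete_vertex)
    then show ?thesis
      using num_edges_delete_vertex[OF rH, of v] by simp
  qed
  have "Suc n * num_edges H = (\<Sum>v\<in>verts H. num_edges H)"
    using H(2) by simp
  also have "\<dots> \<le> (\<Sum>v\<in>verts H. ex_in \<H> n + degree H v)"
    by (rule sum_mono) (rule le)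
  also have "\<dots> = Suc n * ex_in \<H> n + r * num_edges H"
    using H(2) by (simp add: sum.distrib sum_degree[OF rH])
  finally show ?thesis
    using H(3) by (simp add: diff_mult_distrib)
qed

text \<open>The averaging bound divided by
  \<open>(Suc n - r) * (Suc n choose r) = Suc n * (n choose r)\<close>, iterated from
  \<open>m\<close> to \<open>n\<close>.\<close>

lemma ex_in_density_antimono:
  assumes "hereditary r \<H>" "r \<le> m" "m \<le> n"
  shows "real (ex_in \<H> n) / real (n choose r) \<le> real (ex_in \<H> m) / real (m choose r)"
  using assms(3)
proof (induction n rule: dec_induct)
  case (step n)
  have "r \<le> n" using step assms by simp
  have binom: "(Suc n - r) * (Suc n choose r) = Suc n * (n choose r)"
    using binomial_absorb_comp[of "Suc n" r] by simp
  have pos: "0 < n choose r" "0 < Suc n choose r" "0 < Suc n - r"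
    using \<open>r \<le> n\<close> by auto
  have "(Suc n - r) * (ex_in \<H> (Suc n) * (n choose r)) \<le> Suc n * ex_in \<H> n * (n choose r)"
    using mult_right_mono[OF ex_in_Suc_averaging[OF assms(1), of n], of "n choose r"]
    by (simp only: mult.assoc)
  also have "\<dots> = (Suc n - r) * (ex_in \<H> n * (Suc n choose r))"
    using binom by (metis mult.assoc mult.commute)
  finally have "ex_in \<H> (Suc n) * (n choose r) \<le> ex_in \<H> n * (Suc n choose r)"
    using pos(3) by (metis mult_le_cancel1)
  then have "real (ex_in \<H> (Suc n)) * real (n choose r) \<le> real (ex_in \<H> n) * real (Suc n choose r)"
    by (metis of_nat_le_iff of_nat_mult)
  then have "real (ex_in \<H> (Suc n)) / real (Suc n choose r) \<le> real (ex_in \<H> n) / real (n choose r)"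
    using pos by (subst frac_le_eq) (auto simp: divide_simps)
  then show ?case using step by simp
qed simp

text \<open>The densities decrease and are nonnegative, so the \<open>lim\<close> in
  \<open>turan_density\<close> is a genuine limit and lies below every term from \<open>r\<close>
  on.\<close>

lemma turan_ge:
  assumes "\<And>n. family_free r \<F> ({..<n}, {})" "r \<le> n"
  shows "turan_density r \<F> * real (n choose r) \<le> real (turan r \<F> n)"
proof -
  define a where "a n = real (turan r \<F> n) / real (n choose r)" for n
  have antimono: "a n \<le> a m" if "r \<le> m" "m \<le> n" for m n
    using ex_in_density_antimono[OF hereditary_family_free that] assms(1)
    by (simp add: a_def turan_eq_ex_in)
  \<comment> \<open>The shift by \<open>r\<close> skips the indices where the binomial is 0 and the
    quotient is 0 by convention.\<close>
  then have dec: "decseq (\<lambda>n. a (n + r))"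
    by (auto simp: decseq_def)
  obtain L where L: "(\<lambda>n. a (n + r)) \<longlonglongrightarrow> L"
    using decseq_convergent[OF dec, of 0] by (auto simp: a_def)
  then have "a \<longlonglongrightarrow> L"
    by (rule LIMSEQ_offset)
  then have "turan_density r \<F> = L"
    unfolding turan_density_def a_def by (rule limI)
  moreover have "L \<le> a n"
    using decseq_ge[OF dec L, of "n - r"] assms(2) by simp
  ultimately show ?thesis
    using assms(2) by (simp add: a_def field_simps)
qed

section \<open>Cloning a vertex\<close>

text \<open>A new vertex \<open>w\<close> receives the color of \<open>v\<close> and, for each edge
  through \<open>v\<close>, a copy with \<open>w\<close> in place of \<open>v\<close>. No edge
  contains both, so each copy has the same color multiset as its original.\<close>

lemma clone_vertex:
  assumes "H \<in> Col r P" "v \<in> verts H"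
  obtains H' where "H' \<in> Col r P" "card (verts H') = Suc (card (verts H))"
    "num_edges H' = num_edges H + degree H v"
proof -
  have rH: "rgraph r H" and "colorable P H"
    using assms(1) by (auto simp: Col_def)
  then obtain \<phi> where \<phi>: "\<phi> ` verts H \<subseteq> {1..fst P}"
    "\<And>e. e \<in> edges H \<Longrightarrow> image_mset \<phi> (mset_set e) \<in> snd P"
    unfolding colorable_def by blast
  obtain w where w: "w \<notin> verts H"
    using ex_new_if_finite[OF infinite_UNIV_nat finite_verts[OF rH]] by blast
  have edge: "finite e" "e \<subseteq> verts H" "card e = r" "w \<notin> e" if "e \<in> edges H" for e
    using that rH w finite_subset by (auto simp: rgraph_def)
  define swap where "swap e = insert w (e - {v})" for e
  define D where "D = {e \<in> edges H. v \<in> e}"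
  define H' where "H' = (insert w (verts H), edges H \<union> swap ` D)"
  have swap: "finite (swap e)" "card (swap e) = r" "swap e \<subseteq> insert w (verts H)" if "e \<in> D" for e
  proof -
    have e: "v \<in> e" "finite e" "e \<subseteq> verts H" "card e = r" "w \<notin> e"
      using that edge by (auto simp: D_def)
    show "finite (swap e)" "swap e \<subseteq> insert w (verts H)"
      using e by (auto simp: swap_def)
    show "card (swap e) = r"
      using e card_Suc_Diff1[of e v] by (simp add: swap_def)
  qed
  have "rgraph r H'"
    using finite_verts[OF rH] swap edge(2,3) unfolding rgraph_def H'_def by fastforce
  moreover have "colorable P H'"
    unfolding colorable_def
  proof (intro exI[of _ "\<phi>(w := \<phi> v)"] conjI ballI)
    show "(\<phi>(w := \<phi> v)) ` verts H' \<subseteq> {1..fst P}"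
      using \<phi>(1) assms(2) by (auto simp: H'_def)
    fix e assume "e \<in> edges H'"
    then consider "e \<in> edges H" | d where "d \<in> D" "e = swap d"
      by (auto simp: H'_def)
    then show "image_mset (\<phi>(w := \<phi> v)) (mset_set e) \<in> snd P"
    proof cases
      case 1
      then have "image_mset (\<phi>(w := \<phi> v)) (mset_set e) = image_mset \<phi> (mset_set e)"
        using edge by (intro image_mset_cong) auto
      then show ?thesis using \<phi>(2) 1 by simp
    next
      case 2
      then have d: "d \<in> edges H" "v \<in> d" by (auto simp: D_def)
      have "image_mset (\<phi>(w := \<phi> v)) (mset_set (d - {v})) = image_mset \<phi> (mset_set (d - {v}))"
        using edge[OF d(1)] by (intro image_mset_cong) auto
      then have "image_mset (\<phi>(w := \<phi> v)) (mset_set e) = image_mset \<phi> (mset_set d)"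
        using edge[OF d(1)] 2 mset_set.remove[of d v] d(2) by (simp add: swap_def)
      then show ?thesis using \<phi>(2) d by simp
    qed
  qed
  ultimately have "H' \<in> Col r P" by (simp add: Col_def)
  moreover have "card (verts H') = Suc (card (verts H))"
    using w finite_verts[OF rH] by (simp add: H'_def)
  moreover have "num_edges H' = num_edges H + degree H v"
  proof -
    have "inj_on swap D"
    proof (rule inj_onI)
      fix d e assume "d \<in> D" "e \<in> D" "swap d = swap e"
      \<comment> \<open>Exchanging \<open>w\<close> back for \<open>v\<close> is a left inverse of
        \<open>swap\<close> on \<open>D\<close>.\<close>
      moreover have "insert v (swap f - {w}) = f" if "f \<in> D" for f
        using that edge(4)[of f] by (auto simp: swap_def D_def)
      ultimately show "d = e" by metis
    qed
    moreover have "edges H \<inter> swap ` D = {}"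
      using edge(4) by (auto simp: swap_def)
    moreover have "finite D"
      using finite_edges[OF rH] by (simp add: D_def)
    ultimately show ?thesis
      using finite_edges[OF rH]
      by (simp add: num_edges_def degree_def H'_def card_Un_disjoint card_image flip: D_def)
  qed
  ultimately show ?thesis by (rule that)
qed

text \<open>Clone each vertex of an extremal colorable hypergraph and sum the resulting bounds: the
  average degree is \<open>r / n\<close> times the number of edges.\<close>

lemma ex_in_Col_Suc:
  assumes "rpattern r P" "0 < n"
  shows "n * ex_in (Col r P) n + r * ex_in (Col r P) n \<le> n * ex_in (Col r P) (Suc n)"
proof -
  note her = hereditary_Col[OF assms(1)]
  obtain H where H: "H \<in> Col r P" "card (verts H) = n" "num_edges H = ex_in (Col r P) n"
    using ex_in_attained[OF her] .
  have rH: "rgraph r H" using H(1) by (simp add: Col_def)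
  have le: "num_edges H + degree H v \<le> ex_in (Col r P) (Suc n)" if "v \<in> verts H" for v
    using clone_vertex[OF H(1) that] num_edges_le_ex_in[OF her] H(2) by metis
  have "n * num_edges H + r * num_edges H = (\<Sum>v\<in>verts H. num_edges H + degree H v)"
    using H(2) by (simp add: sum.distrib sum_degree[OF rH])
  also have "\<dots> \<le> (\<Sum>v\<in>verts H. ex_in (Col r P) (Suc n))"
    by (rule sum_mono) (rule le)
  finally show ?thesis using H by simp
qed

text \<open>The identity \<open>r * (n choose r) = n * (n - 1 choose (r - 1))\<close> turns a
  density bound into a bound on the average degree, hence on the gain from cloning.\<close>

lemma ex_in_Col_increment:
  assumes "rpattern r P" "0 < r" "0 < n" "c * real (n choose r) \<le> real (ex_in (Col r P) n)"
  shows "real (ex_in (Col r P) n) + c * real (n - 1 choose (r - 1)) \<le> real (ex_in (Col r P) (Suc n))"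
proof -
  have "real n * (c * real (n - 1 choose (r - 1))) = c * real (n * (n - 1 choose (r - 1)))"
    by simp
  also have "n * (n - 1 choose (r - 1)) = r * (n choose r)"
    using times_binomial_minus1_eq[OF assms(2), of n] by simp
  finally have "real n * (c * real (n - 1 choose (r - 1))) = real r * (c * real (n choose r))"
    by simp
  also have "\<dots> \<le> real r * real (ex_in (Col r P) n)"
    using assms(4) by (intro mult_left_mono) auto
  finally have "real n * (real (ex_in (Col r P) n) + c * real (n - 1 choose (r - 1)))
      \<le> real (n * ex_in (Col r P) n + r * ex_in (Col r P) n)"
    by (simp add: algebra_simps)
  also have "\<dots> \<le> real n * real (ex_in (Col r P) (Suc n))"
    using ex_in_Col_Suc[OF assms(1,3)] by (metis of_nat_le_iff of_nat_mult)
  finally show ?thesis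
    using assms(3) by simp
qed

section \<open>Removing vertices of small degree\<close>

lemma obtain_min_degree_vertex:
  assumes "finite (verts H)" "verts H \<noteq> {}"
  obtains v where "v \<in> verts H" "degree H v = min_degree H"
proof -
  have "min_degree H \<in> degree H ` verts H"
    unfolding min_degree_def using assms by (intro Min_in) auto
  then show ?thesis using that by auto
qed

text \<open>
  The last alternative is that the deletion runs down to \<open>M\<close> vertices, which is impossible for large
  \<open>H\<close>; \<open>x\<close> is the surplus accumulated so far.
\<close>

lemma remove_small_degree_vertices:
  fixes g d :: "nat \<Rightarrow> real"
  assumes "hereditary r \<H>" "H \<in> \<H>" "M \<le> card (verts H)"
    and step: "\<And>m. M < m \<Longrightarrow> g (m - 1) + d m + 1 \<le> g m"
    and "g (card (verts H)) + x \<le> real (num_edges H)"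
  shows "(\<exists>H'\<in>\<H>. M < card (verts H') \<and> d (card (verts H')) \<le> real (min_degree H') \<and>
            g (card (verts H')) + x \<le> real (num_edges H') \<and>
            (H' = H \<or> g (card (verts H')) + x < real (num_edges H'))) \<or>
         g M + x + real (card (verts H) - M) \<le> 2 ^ M"
  using assms(2,3,5)
proof (induction "card (verts H) - M" arbitrary: H x)
  case 0
  then have "card (verts H) = M" "rgraph r H"
    using assms(1) by (auto simp: hereditary_def)
  \<comment> \<open>On \<open>M\<close> vertices there are at most \<open>2 ^ M\<close> edges, which
    bounds \<open>g M + x\<close>.\<close>
  then show ?case
    using num_edges_le[of r H] 0 by (metis of_nat_le_iff of_nat_numeral of_nat_power add_0_right
        of_nat_0 order_trans)
next
  case (Suc k)
  let ?n = "card (verts H)"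
  have rH: "rgraph r H" using assms(1) Suc.prems by (simp add: hereditary_def)
  have n: "M < ?n" using Suc.hyps by simp
  show ?case
  proof (cases "d ?n \<le> real (min_degree H)")
    case True
    then show ?thesis using Suc.prems n by blast
  next
    case False
    have "verts H \<noteq> {}" using n by auto
    then obtain v where v: "v \<in> verts H" "degree H v = min_degree H"
      using obtain_min_degree_vertex[OF finite_verts[OF rH]] by blast
    let ?K = "delete_vertex v H"
    have K: "?K \<in> \<H>" "card (verts ?K) = ?n - 1"
      using assms(1) Suc.prems(1) v by (auto simp: hereditary_def card_verts_delete_vertex)
    have "real (num_edges ?K) = real (num_edges H) - real (min_degree H)"
      using num_edges_delete_vertex[OF rH, of v] v(2) by linarith
    \<comment> \<open>The deletion loses fewer than \<open>d ?n\<close> edges while \<open>g\<close>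
      drops by at least \<open>d ?n + 1\<close>, so the surplus grows by 1.\<close>
    then have "g (card (verts ?K)) + (x + 1) \<le> real (num_edges ?K)"
      using step[OF n] Suc.prems(3) False unfolding K(2) by linarith
    moreover have "k = card (verts ?K) - M" "M \<le> card (verts ?K)"
      using Suc.hyps(2) K(2) n by auto
    ultimately consider
        H' where "H' \<in> \<H>" "M < card (verts H')" "d (card (verts H')) \<le> real (min_degree H')"
          "g (card (verts H')) + (x + 1) \<le> real (num_edges H')"
      | "g M + (x + 1) + real (card (verts ?K) - M) \<le> 2 ^ M"
      using Suc.hyps(1)[of ?K "x + 1"] K(1) by blast
    then show ?thesis
    proof cases
      \<comment> \<open>A surplus of at least \<open>x + 1\<close> yields the strict inequality
        required when vertices were deleted.\<close>
      case 1
      then show ?thesis by (intro disjI1 bexI[of _ H']) auto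
    next
      case 2
      then show ?thesis using K(2) n by auto
    qed
  qed
qed

section \<open>Degree thresholds against binomial coefficients\<close>

text \<open>The right-hand side is the product of the \<open>k\<close> factors \<open>n + 1\<close>,
  ..., \<open>n + k\<close>.\<close>

lemma power_le_fact_times_binomial: "Suc n ^ k \<le> fact k * ((n + k) choose k)"
proof (induction k)
  case (Suc k)
  have "Suc n ^ Suc k \<le> Suc (n + k) * (fact k * ((n + k) choose k))"
    using Suc by (simp only: power_Suc) (intro mult_mono, auto)
  also have "\<dots> = fact (Suc k) * ((n + Suc k) choose Suc k)"
    using Suc_times_binomial_eq[of "n + k" k] by (simp add: algebra_simps)
  finally show ?case .
qed simp

text \<open>Both sides are of order \<open>m ^ k\<close>, with leading coefficients differing by
  \<epsilon>. Half of \<epsilon> absorbs the lower-order terms of the binomial, the other half the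
  summand 1. The shift by 2 matches the gain from cloning on \<open>m - 1\<close> vertices.\<close>

lemma eventually_power_le_binomial:
  fixes c \<epsilon> :: real
  assumes "0 \<le> c" "0 < \<epsilon>" "0 < k"
  shows "\<forall>\<^sub>F m in sequentially.
    (c / fact k - \<epsilon>) * real m ^ k + 1 \<le> c * real (m - 2 choose k)"
proof -
  \<comment> \<open>The offset \<open>Suc k\<close> arises because \<open>m - (k + 1)\<close> is the
    least factor of \<open>fact k * (m - 2 choose k)\<close>.\<close>
  have "(\<lambda>m. c / fact k * (1 - real (Suc k) / real m) ^ k) \<longlonglongrightarrow> c / fact k * (1 - 0) ^ k"
    by (intro tendsto_intros lim_const_over_n)
  then have "\<forall>\<^sub>F m in sequentially. c / fact k - \<epsilon> / 2 < c / fact k * (1 - real (Suc k) / real m) ^ k"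
    using assms(2) by (intro order_tendstoD) auto
  moreover have "\<forall>\<^sub>F m in sequentially. 2 / \<epsilon> \<le> real m"
    using filterlim_real_sequentially by (simp add: filterlim_at_top)
  moreover have "\<forall>\<^sub>F m in sequentially. k + 2 \<le> m"
    by (rule eventually_ge_at_top)
  ultimately show ?thesis
  proof eventually_elim
    case (elim m)
    have m: "0 < real m" using elim(3) by simp
    have "1 \<le> real m" using elim(3) by simp
    then have "real m \<le> real m ^ k"
      using assms(3) by (metis One_nat_def Suc_leI power_increasing power_one_right)
    moreover have "1 \<le> \<epsilon> / 2 * real m"
      using elim(2) assms(2) by (simp add: field_simps)
    ultimately have "1 \<le> \<epsilon> / 2 * real m ^ k"
      using assms(2) by (smt (verit) half_gt_zero mult_left_mono)
    then have "(c / fact k - \<epsilon>) * real m ^ k + 1 \<le> (c / fact k - \<epsilon> / 2) * real m ^ k"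
      by (simp add: algebra_simps)
    also have "\<dots> \<le> (c / fact k * (1 - real (Suc k) / real m) ^ k) * real m ^ k"
      using elim(1) by (intro mult_right_mono) auto
    also have "\<dots> = c / fact k * ((1 - real (Suc k) / real m) * real m) ^ k"
      by (simp only: power_mult_distrib mult.assoc)
    also have "(1 - real (Suc k) / real m) * real m = real (Suc (m - 2 - k))"
      using m elim(3) by (simp add: field_simps of_nat_diff)
    also have "c / fact k * real (Suc (m - 2 - k)) ^ k \<le> c / fact k * (fact k * real (m - 2 choose k))"
    proof (rule mult_left_mono)
      have "real (Suc (m - 2 - k) ^ k) \<le> real (fact k * (m - 2 choose k))"
        using power_le_fact_times_binomial[of "m - 2 - k" k] elim(3) by (subst of_nat_le_iff) auto
      then show "real (Suc (m - 2 - k)) ^ k \<le> fact k * real (m - 2 choose k)"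
        by simp
    qed (use assms(1) in simp)
    also have "\<dots> = c * real (m - 2 choose k)"
      by simp
    finally show ?case .
  qed
qed

section \<open>From degree stability to the exact extremal number\<close>

theorem theorem5p1:
  fixes r :: nat and P :: pattern and \<F> :: "hgraph set"
  assumes "r \<ge> 2"
    and "rpattern r P"
    and "\<forall>F\<in>\<F>. rgraph r F \<and> \<not> has_isolated_vertex F"
    and "degree_stable r \<F> (Col r P)"
  shows "\<exists>N. \<forall>n\<ge>N. \<forall>G. rgraph r G \<and> card (verts G) = n \<and> family_free r \<F> G \<longrightarrow>
           num_edges G \<le> ex_in (Col r P) n \<and>
           (num_edges G = ex_in (Col r P) n \<longrightarrow> colorable P G)"
proof -
  define \<A> where "\<A> = {H. rgraph r H \<and> family_free r \<F> H}"
  define \<pi> where "\<pi> = turan_density r \<F>"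
  let ?c = "ex_in (Col r P)"
  have \<pi>_pos: "0 < \<pi>" and Col_free: "\<And>H. H \<in> Col r P \<Longrightarrow> family_free r \<F> H"
    using assms(4) by (auto simp: degree_stable_def \<pi>_def)
  obtain n0 :: nat and \<epsilon> :: real where "0 < \<epsilon>" and
    n0: "\<forall>H. rgraph r H \<and> family_free r \<F> H \<and> card (verts H) \<ge> n0 \<and>
             real (min_degree H) \<ge> (\<pi> / fact (r - 1) - \<epsilon>) * real (card (verts H)) ^ (r - 1)
           \<longrightarrow> H \<in> Col r P"
    using assms(4) unfolding degree_stable_def \<pi>_def by blast
  define d where "d m = (\<pi> / fact (r - 1) - \<epsilon>) * real m ^ (r - 1)" for m
  have stable: "H \<in> Col r P"
    if "H \<in> \<A>" "n0 \<le> card (verts H)" "d (card (verts H)) \<le> real (min_degree H)" for H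
    using that n0 unfolding \<A>_def d_def by blast
  note herC = hereditary_Col[OF assms(2)]
  \<comment> \<open>Edgeless hypergraphs are colorable, and degree stability makes all colorable
    hypergraphs \<F>-free.\<close>
  have free: "family_free r \<F> ({..<n}, {})" for n
    using herC Col_free by (simp add: hereditary_def)
  then have herA: "hereditary r \<A>"
    unfolding \<A>_def by (rule hereditary_family_free)
  obtain M0 where M0: "\<And>m. M0 \<le> m \<Longrightarrow> d m + 1 \<le> \<pi> * real (m - 2 choose (r - 1))"
    using eventually_power_le_binomial[of \<pi> \<epsilon> "r - 1"] \<pi>_pos \<open>0 < \<epsilon>\<close> assms(1)
    by (auto simp: eventually_sequentially d_def)
  \<comment> \<open>Above \<open>M\<close> stability applies, the increment bound dominates the
    threshold, and \<open>m choose r\<close> is positive.\<close>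
  define M where "M = max (max n0 M0) r"
  have M: "n0 \<le> M" "M0 \<le> M" "r \<le> M" by (auto simp: M_def)

  have c_ge: "\<pi> * real (m choose r) \<le> real (?c m)" if "M \<le> m" for m
  proof -
    \<comment> \<open>Reaching \<open>m\<close> vertices would take \<open>2 ^ m + 1\<close>
      deletions, and so produce a surplus too large for \<open>m\<close> vertices.\<close>
    define n where "n = m + 2 ^ m + 1"
    obtain H where H: "H \<in> \<A>" "card (verts H) = n" "num_edges H = turan r \<F> n"
      using ex_in_attained[OF herA] unfolding turan_eq_ex_in \<A>_def by metis
    have "\<pi> * real (n choose r) + 0 \<le> real (num_edges H)"
      using turan_ge[OF free, of n] M that H(3) by (simp add: \<pi>_def n_def)
    \<comment> \<open>By Pascal's rule the comparison function grows by
      \<open>\<pi> * (k - 1 choose (r - 1))\<close>, which is at least the bound from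
      \<open>M0\<close>.\<close>
    moreover have "\<pi> * real (k - 1 choose r) + d k + 1 \<le> \<pi> * real (k choose r)" if "m < k" for k
    proof -
      have "k choose r = (k - 1 choose (r - 1)) + (k - 1 choose r)"
        using assms(1) that by (intro choose_reduce_nat) auto
      moreover have "\<pi> * real (k - 2 choose (r - 1)) \<le> \<pi> * real (k - 1 choose (r - 1))"
        using \<pi>_pos by (intro mult_left_mono) (auto intro: binomial_right_mono)
      moreover have "d k + 1 \<le> \<pi> * real (k - 2 choose (r - 1))"
        using M0 M \<open>M \<le> m\<close> that by simp
      ultimately show ?thesis by (simp add: algebra_simps)
    qed
    moreover have "\<not> \<pi> * real (m choose r) + 0 + real (card (verts H) - m) \<le> 2 ^ m"
      using \<pi>_pos H(2) by (simp add: n_def not_le add_nonneg_pos)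
    ultimately obtain H' where H': "H' \<in> \<A>" "m < card (verts H')"
      "d (card (verts H')) \<le> real (min_degree H')"
      "\<pi> * real (card (verts H') choose r) \<le> real (num_edges H')"
      using remove_small_degree_vertices[OF herA H(1),
          of m "\<lambda>k. \<pi> * real (k choose r)" d 0] H(2) by (auto simp: n_def)
    let ?k = "card (verts H')"
    have "H' \<in> Col r P"
      using stable[OF H'(1)] H' M that by simp
    then have "\<pi> * real (?k choose r) \<le> real (?c ?k)"
      using num_edges_le_ex_in[OF herC] H'(4) by (meson of_nat_le_iff order_trans)
    then have "\<pi> \<le> real (?c ?k) / real (?k choose r)"
      using M that H'(2) by (simp add: field_simps)
    \<comment> \<open>The order \<open>?k\<close> of \<open>H'\<close> is not controlled, but it
      exceeds \<open>m\<close>, so monotonicity of densities carries the bound down to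
      \<open>m\<close>.\<close>
    also have "\<dots> \<le> real (?c m) / real (m choose r)"
      using M that H'(2) by (intro ex_in_density_antimono[OF herC]) auto
    finally show ?thesis
      using M that by (simp add: field_simps)
  qed

  \<comment> \<open>Cloning from \<open>m - 1\<close> to \<open>m\<close> vertices gains at least
    \<open>\<pi> * (m - 2 choose (r - 1))\<close>, which exceeds \<open>d m\<close> by at least
    1.\<close>
  have c_step: "real (?c (m - 1)) + d m + 1 \<le> real (?c m)" if "M < m" for m
    using ex_in_Col_increment[OF assms(2), of "m - 1" \<pi>] c_ge[of "m - 1"] M0[of m] M that assms(1)
    by (simp add: numeral_2_eq_2)

  have main: "G \<in> Col r P"
    if G: "G \<in> \<A>" "M + 2 ^ M < card (verts G)" "?c (card (verts G)) \<le> num_edges G" for G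
  proof -
    have "\<not> real (?c M) + 0 + real (card (verts G) - M) \<le> 2 ^ M"
    proof -
      have "2 ^ M < card (verts G) - M" using G(2) by simp
      then have "(2::real) ^ M < real (card (verts G) - M)"
        by (metis of_nat_less_iff of_nat_numeral of_nat_power)
      then show ?thesis by linarith
    qed
    then obtain H where H: "H \<in> \<A>" "M < card (verts H)" "d (card (verts H)) \<le> real (min_degree H)"
      "H = G \<or> ?c (card (verts H)) < num_edges H"
      using remove_small_degree_vertices[OF herA G(1), of M "\<lambda>m. real (?c m)" d 0] c_step G
      by auto
    have "H \<in> Col r P"
      using stable[OF H(1)] H M by simp
    \<comment> \<open>A colorable \<open>H\<close> cannot exceed \<open>?c\<close>, so
      \<open>H = G\<close>.\<close>
    then show ?thesis
      using H(4) num_edges_le_ex_in[OF herC] by (metis leD)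
  qed
  show ?thesis
  proof (intro exI[of _ "M + 2 ^ M + 1"] allI impI)
    fix n G
    assume "M + 2 ^ M + 1 \<le> n" and G: "rgraph r G \<and> card (verts G) = n \<and> family_free r \<F> G"
    then have "G \<in> Col r P" if "?c n \<le> num_edges G"
      using main[of G] that by (simp add: \<A>_def)
    moreover have "num_edges G \<le> ?c n" "colorable P G" if "G \<in> Col r P"
      using num_edges_le_ex_in[OF herC that] G that by (simp_all add: Col_def)
    ultimately show "num_edges G \<le> ?c n \<and> (num_edges G = ?c n \<longrightarrow> colorable P G)"
      \<comment> \<open>If \<open>num_edges G\<close> is at least \<open>?c n\<close>, then
        \<open>G\<close> is colorable and hence has at most \<open>?c n\<close> edges; otherwise the
        bound is immediate.\<close>
      using nat_le_linear by auto
  qed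
qed

end
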